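(* Let $(\Phi,G)$ and $(\Psi,H)$ be perception pairs and let $T\colon G\to H$ be a group homomorphism. If $\Psi$ is convex, then the set of GENEOs from $(\Phi,G)$ to $(\Psi,H)$ with respect to $T$ is convex; that is, if $(F_1,T)$ and $(F_2,T)$ are GENEOs from $(\Phi,G)$ to $(\Psi,H)$ and $0\le t\le 1$, then $(tF_1+(1-t)F_2,\,T)$ is a GENEO from $(\Phi,G)$ to $(\Psi,H)$, where $(tF_1+(1-t)F_2)(\varphi):=tF_1(\varphi)+(1-t)F_2(\varphi)$.
   Context: Perception pair: let $\Phi$ be a set of bounded functions from a set $X$ to $\mathbb{R}^n$ (for some $n\in\mathbb{N}$), endowed with the uniform metric $\lVert\varphi_1-\varphi_2\rVert_\infty=\sup_{x\in X}\lVert\varphi_1(x)-\varphi_2(x)\rVert_\infty$. $\mathrm{Aut}_\Phi(X)$ is the group (under composition) of all bijections $g\colon X\to X$ such that $\varphi g,\varphi g^{-1}\in\Phi$ for every $\varphi\in\Phi$, where $\varphi g=\varphi\circ g$. A perception pair is a pair $(\Phi,G)$ with $G$ a subgroup of $\mathrm{Aut}_\Phi(X)$. The functions in $\Psi$ may be defined on a different set $Y$. Convexity of $\Psi$ is meant in the vector space of functions with the same domain and codomain. GENEO: a pair $(F,T)$ with $F\colon\Phi\to\Psi$ and $T\colon G\to H$ is a Group Equivariant Non-Expansive Operator from $(\Phi,G)$ to $(\Psi,H)$ if $T$ is a group homomorphism, $F(\varphi g)=F(\varphi)T(g)$ for all $\varphi\in\Phi$, $g\in G$, and $\lVert F(\varphi_1)-F(\varphi_2)\rVert_\infty\le\lVert\varphi_1-\varphi_2\rVert_\infty$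 for all $\varphi_1,\varphi_2\in\Phi$. *)

theory Defs
  imports "HOL-Analysis.Analysis" "HOL-Algebra.Bij"
begin

text \<open>
  A function with domain \<open>X\<close> is represented by an extensional function
  (value \<open>undefined\<close> outside \<open>X\<close>), as in the library's \<^const>\<open>BijGroup\<close>;
  the composite \<open>\<phi> \<circ> g\<close> of functions on \<open>X\<close> is then \<^term>\<open>compose X \<phi> g\<close>.
\<close>

definition bounded_funs :: "'x set \<Rightarrow> ('x \<Rightarrow> real ^ 'n) set" where
  "bounded_funs X = {\<phi> \<in> X \<rightarrow>\<^sub>E UNIV. bounded (\<phi> ` X)}"

text \<open>
  \<^const>\<open>infnorm\<close> is the maximum norm on \<open>real ^ 'n\<close>. The supremum is taken in
  the nonnegative reals: inserting \<open>0\<close> matters only for empty \<open>X\<close>, where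
  \<^const>\<open>Sup\<close> on the reals would be unspecified.
\<close>

definition sup_dist :: "'x set \<Rightarrow> ('x \<Rightarrow> real ^ 'n) \<Rightarrow> ('x \<Rightarrow> real ^ 'n) \<Rightarrow> real" where
  "sup_dist X \<phi>\<^sub>1 \<phi>\<^sub>2 = Sup (insert 0 ((\<lambda>x. infnorm (\<phi>\<^sub>1 x - \<phi>\<^sub>2 x)) ` X))"

definition Aut :: "'x set \<Rightarrow> ('x \<Rightarrow> real ^ 'n) set \<Rightarrow> ('x \<Rightarrow> 'x) monoid" where
  "Aut X \<Phi> = (BijGroup X)\<lparr>carrier :=
     {g \<in> Bij X. \<forall>\<phi>\<in>\<Phi>. compose X \<phi> g \<in> \<Phi> \<and> compose X \<phi> (restrict (inv_into X g) X) \<in> \<Phi>}\<rparr>"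

definition perception_pair ::
    "'x set \<Rightarrow> ('x \<Rightarrow> real ^ 'n) set \<Rightarrow> ('x \<Rightarrow> 'x) set \<Rightarrow> bool" where
  "perception_pair X \<Phi> G \<longleftrightarrow> \<Phi> \<subseteq> bounded_funs X \<and> subgroup G (Aut X \<Phi>)"

lemma group_Aut:
  assumes "\<Phi> \<subseteq> bounded_funs X"
  shows "group (Aut X \<Phi>)"
proof -
  let ?S = "{g \<in> Bij X. \<forall>\<phi>\<in>\<Phi>. compose X \<phi> g \<in> \<Phi> \<and> compose X \<phi> (restrict (inv_into X g) X) \<in> \<Phi>}"
  interpret B: group "BijGroup X" by (rule group_BijGroup)
  have car: "carrier (BijGroup X) = Bij X" by (simp add: BijGroup_def)
  have invB: "inv\<^bsub>BijGroup X\<^esub> g = restrict (inv_into X g) X" if "g \<in> Bij X" for g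
    using that by (simp add: inv_BijGroup)
  have multB: "g \<otimes>\<^bsub>BijGroup X\<^esub> h = compose X g h" if "g \<in> Bij X" "h \<in> Bij X" for g h
    using that by (simp add: BijGroup_def)
  have oneB: "\<one>\<^bsub>BijGroup X\<^esub> = (\<lambda>x\<in>X. x)" by (simp add: BijGroup_def)
  have funX: "g \<in> X \<rightarrow> X" if "g \<in> Bij X" for g
    using that by (rule Bij_imp_funcset)
  have assoc: "compose X \<phi> (compose X g h) = compose X (compose X \<phi> g) h" if "h \<in> Bij X"
    for \<phi> :: "'a \<Rightarrow> real ^ 'b" and g h
    using compose_assoc[OF funX[OF that]] by metis
  have "subgroup ?S (BijGroup X)"
  proof (rule B.subgroupI)
    show "?S \<subseteq> carrier (BijGroup X)" by (auto simp: car)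
    have one: "(\<lambda>x\<in>X. x) \<in> Bij X" using B.one_closed by (simp add: car oneB)
    have inv1: "restrict (inv_into X (\<lambda>x\<in>X. x)) X = (\<lambda>x\<in>X. x)"
      using B.inv_one invB[OF one] by (simp add: oneB)
    have "compose X \<phi> (\<lambda>x\<in>X. x) = \<phi>" if "\<phi> \<in> \<Phi>" for \<phi>
      using that assms by (auto simp: bounded_funs_def compose_def PiE_def intro!: extensionalityI[of _ X])
    then show "?S \<noteq> {}" using one inv1 by fastforce
  next
    fix g assume g: "g \<in> ?S"
    then have gB: "g \<in> Bij X" by simp
    have iB: "restrict (inv_into X g) X \<in> Bij X" using gB B.inv_closed[of g] by (simp add: car invB)
    have "restrict (inv_into X (restrict (inv_into X g) X)) X = g"
      using B.inv_inv[of g] gB iB invB[OF gB] invB[OF iB] by (simp add: car)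
    then show "inv\<^bsub>BijGroup X\<^esub> g \<in> ?S" using g iB by (simp add: invB)
  next
    fix g h assume g: "g \<in> ?S" and h: "h \<in> ?S"
    have gB: "g \<in> Bij X" and hB: "h \<in> Bij X" using g h by auto
    have cB: "compose X g h \<in> Bij X" using B.m_closed[of g h] gB hB by (simp add: car multB)
    have iB: "restrict (inv_into X g) X \<in> Bij X" "restrict (inv_into X h) X \<in> Bij X"
      using B.inv_closed[of g] B.inv_closed[of h] gB hB by (simp_all add: car invB)
    have "restrict (inv_into X (compose X g h)) X
        = compose X (restrict (inv_into X h) X) (restrict (inv_into X g) X)"
      using B.inv_mult_group[of g h] gB hB cB iB by (simp add: car multB invB)
    then show "g \<otimes>\<^bsub>BijGroup X\<^esub> h \<in> ?S"
      using g h cB iB by (simp add: multB assoc)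
  qed
  then have "group ((BijGroup X)\<lparr>carrier := ?S\<rparr>)"
    by (rule B.subgroup_imp_group)
  then show ?thesis by (simp add: Aut_def)
qed

definition GENEO ::
    "'x set \<Rightarrow> ('x \<Rightarrow> real ^ 'n) set \<Rightarrow> ('x \<Rightarrow> 'x) set \<Rightarrow>
     'y set \<Rightarrow> ('y \<Rightarrow> real ^ 'm) set \<Rightarrow> ('y \<Rightarrow> 'y) set \<Rightarrow>
     (('x \<Rightarrow> real ^ 'n) \<Rightarrow> ('y \<Rightarrow> real ^ 'm)) \<Rightarrow> (('x \<Rightarrow> 'x) \<Rightarrow> ('y \<Rightarrow> 'y)) \<Rightarrow> bool" where
  "GENEO X \<Phi> G Y \<Psi> H F T \<longleftrightarrow>
     F \<in> \<Phi> \<rightarrow>\<^sub>E \<Psi> \<and>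
     T \<in> hom ((Aut X \<Phi>)\<lparr>carrier := G\<rparr>) ((Aut Y \<Psi>)\<lparr>carrier := H\<rparr>) \<and>
     (\<forall>\<phi>\<in>\<Phi>. \<forall>g\<in>G. F (compose X \<phi> g) = compose Y (F \<phi>) (T g)) \<and>
     (\<forall>\<phi>\<^sub>1\<in>\<Phi>. \<forall>\<phi>\<^sub>2\<in>\<Phi>. sup_dist Y (F \<phi>\<^sub>1) (F \<phi>\<^sub>2) \<le> sup_dist X \<phi>\<^sub>1 \<phi>\<^sub>2)"

text \<open>
  The library's \<^const>\<open>convex\<close> needs a type of class \<^class>\<open>real_vector\<close>, but the
  vector spaces here consist of the functions on a given carrier set. So convexity
  is spelled out relative to the pointwise combination \<open>t f + (1 - t) g\<close> on that
  carrier.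
\<close>

definition convex_wrt :: "(real \<Rightarrow> 'f \<Rightarrow> 'f \<Rightarrow> 'f) \<Rightarrow> 'f set \<Rightarrow> bool" where
  "convex_wrt comb S \<longleftrightarrow> (\<forall>f\<in>S. \<forall>g\<in>S. \<forall>t. 0 \<le> t \<and> t \<le> 1 \<longrightarrow> comb t f g \<in> S)"

lemma convex_wrt_scaleR:
  "convex_wrt (\<lambda>t f g. t *\<^sub>R f + (1 - t) *\<^sub>R g) S \<longleftrightarrow> convex S"
proof
  assume L: "convex_wrt (\<lambda>t f g. t *\<^sub>R f + (1 - t) *\<^sub>R g) S"
  show "convex S" unfolding convex_def
  proof (intro ballI allI impI)
    fix x y and u v :: real
    assume "x \<in> S" "y \<in> S" "0 \<le> u" "0 \<le> v" "u + v = 1"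
    moreover from this have "v = 1 - u" "u \<le> 1" by auto
    ultimately show "u *\<^sub>R x + v *\<^sub>R y \<in> S" using L unfolding convex_wrt_def by blast
  qed
qed (auto simp: convex_wrt_def convex_def)

definition fun_comb ::
    "'y set \<Rightarrow> real \<Rightarrow> ('y \<Rightarrow> real ^ 'm) \<Rightarrow> ('y \<Rightarrow> real ^ 'm) \<Rightarrow> ('y \<Rightarrow> real ^ 'm)" where
  "fun_comb Y t \<psi>\<^sub>1 \<psi>\<^sub>2 = (\<lambda>y\<in>Y. t *\<^sub>R \<psi>\<^sub>1 y + (1 - t) *\<^sub>R \<psi>\<^sub>2 y)"

definition op_comb ::
    "'p set \<Rightarrow> 'y set \<Rightarrow> real \<Rightarrow> ('p \<Rightarrow> 'y \<Rightarrow> real ^ 'm) \<Rightarrow> ('p \<Rightarrow> 'y \<Rightarrow> real ^ 'm) \<Rightarrow>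
     ('p \<Rightarrow> 'y \<Rightarrow> real ^ 'm)" where
  "op_comb \<Phi> Y t F\<^sub>1 F\<^sub>2 = (\<lambda>\<phi>\<in>\<Phi>. fun_comb Y t (F\<^sub>1 \<phi>) (F\<^sub>2 \<phi>))"

end

theory Submission
  imports Defs
begin

text \<open>Each defining property of a GENEO survives convex combination, since combinations are
  taken pointwise on \<open>Y\<close> with \<open>T\<close> fixed. Values stay in
  \<open>\<Psi>\<close> because \<open>\<Psi>\<close> is convex. Equivariance survives because
  precomposition with \<open>T g\<close> is linear in the function
  (\<open>compose_fun_comb\<close>). Non-expansiveness survives because the difference of two
  combinations with the same weights is the combination of the differences, so the triangle
  inequality bounds it by t c + (1 - t) c = c, where c is the distance of the two inputs
  (\<open>sup_dist_fun_comb_le\<close>). \<open>GENEO_op_comb\<close> assembles these facts.\<close>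

text \<open>Trades the supremum for pointwise bounds. Boundedness of the functions makes the set of
  distances bounded above, so that \<open>Sup\<close> is a genuine least upper bound; the conjunct 0
  \<le> c comes from the inserted 0 and carries content when \<open>X\<close> is empty.\<close>

lemma sup_dist_le_iff:
  assumes "\<phi> \<in> bounded_funs X" "\<psi> \<in> bounded_funs X"
  shows "sup_dist X \<phi> \<psi> \<le> c \<longleftrightarrow> 0 \<le> c \<and> (\<forall>x\<in>X. infnorm (\<phi> x - \<psi> x) \<le> c)"
proof -
  have "bounded (\<phi> ` X)" "bounded (\<psi> ` X)"
    using assms by (auto simp: bounded_funs_def)
  then obtain a b where ab: "\<And>x. x \<in> X \<Longrightarrow> norm (\<phi> x) \<le> a" "\<And>x. x \<in> X \<Longrightarrow> norm (\<psi> x) \<le> b"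
    by (auto simp: bounded_iff)
  \<comment> \<open>\<open>bounded\<close> speaks of the Euclidean norm, which dominates
    \<open>infnorm\<close>.\<close>
  have "infnorm (\<phi> x - \<psi> x) \<le> a + b" if "x \<in> X" for x
    using infnorm_le_norm[of "\<phi> x - \<psi> x"] norm_triangle_ineq4[of "\<phi> x" "\<psi> x"] ab[OF that]
    by linarith
  then have "bdd_above ((\<lambda>x. infnorm (\<phi> x - \<psi> x)) ` X)"
    by (rule bdd_aboveI2)
  then show ?thesis
    unfolding sup_dist_def by (subst cSup_le_iff) auto
qed

text \<open>Closed balls of a norm are convex. The bound \<open>c\<close> is arbitrary so that both
  operators can later share the distance of their inputs.\<close>

lemma sup_dist_fun_comb_le:
  assumes "\<psi>\<^sub>1 \<in> bounded_funs Y" "\<psi>\<^sub>2 \<in> bounded_funs Y"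
    and "\<chi>\<^sub>1 \<in> bounded_funs Y" "\<chi>\<^sub>2 \<in> bounded_funs Y"
    and "fun_comb Y t \<psi>\<^sub>1 \<psi>\<^sub>2 \<in> bounded_funs Y" "fun_comb Y t \<chi>\<^sub>1 \<chi>\<^sub>2 \<in> bounded_funs Y"
    and "sup_dist Y \<psi>\<^sub>1 \<chi>\<^sub>1 \<le> c" "sup_dist Y \<psi>\<^sub>2 \<chi>\<^sub>2 \<le> c"
    and t: "0 \<le> t" "t \<le> 1"
  shows "sup_dist Y (fun_comb Y t \<psi>\<^sub>1 \<psi>\<^sub>2) (fun_comb Y t \<chi>\<^sub>1 \<chi>\<^sub>2) \<le> c"
proof -
  have c: "0 \<le> c"
    and le: "\<And>y. y \<in> Y \<Longrightarrow> infnorm (\<psi>\<^sub>1 y - \<chi>\<^sub>1 y) \<le> c"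
      "\<And>y. y \<in> Y \<Longrightarrow> infnorm (\<psi>\<^sub>2 y - \<chi>\<^sub>2 y) \<le> c"
    using assms by (simp_all add: sup_dist_le_iff)
  have "infnorm (fun_comb Y t \<psi>\<^sub>1 \<psi>\<^sub>2 y - fun_comb Y t \<chi>\<^sub>1 \<chi>\<^sub>2 y) \<le> c" if y: "y \<in> Y" for y
  proof -
    have "fun_comb Y t \<psi>\<^sub>1 \<psi>\<^sub>2 y - fun_comb Y t \<chi>\<^sub>1 \<chi>\<^sub>2 y
        = t *\<^sub>R (\<psi>\<^sub>1 y - \<chi>\<^sub>1 y) + (1 - t) *\<^sub>R (\<psi>\<^sub>2 y - \<chi>\<^sub>2 y)"
      using y by (simp add: fun_comb_def algebra_simps)
    also have "infnorm \<dots> \<le> t * infnorm (\<psi>\<^sub>1 y - \<chi>\<^sub>1 y) + (1 - t) * infnorm (\<psi>\<^sub>2 y - \<chi>\<^sub>2 y)"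
      using infnorm_triangle[of "t *\<^sub>R (\<psi>\<^sub>1 y - \<chi>\<^sub>1 y)" "(1 - t) *\<^sub>R (\<psi>\<^sub>2 y - \<chi>\<^sub>2 y)"] t
      by (simp add: infnorm_mul)
    \<comment> \<open>A convex combination of two numbers that are at most \<open>c\<close> is at
      most \<open>c\<close>.\<close>
    also have "\<dots> \<le> c"
      using le[OF y] t by (intro convex_bound_le) auto
    finally show ?thesis .
  qed
  with c show ?thesis
    using assms by (simp add: sup_dist_le_iff)
qed

text \<open>The combination has its pointwise formula only on \<open>Y\<close>, so \<open>h\<close>
  has to keep points of \<open>Y\<close> inside \<open>Y\<close>.\<close>

lemma compose_fun_comb:
  assumes "h \<in> Y \<rightarrow> Y"
  shows "compose Y (fun_comb Y t \<psi>\<^sub>1 \<psi>\<^sub>2) h = fun_comb Y t (compose Y \<psi>\<^sub>1 h) (compose Y \<psi>\<^sub>2 h)"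
  using assms by (auto simp: compose_def fun_comb_def fun_eq_iff)

lemma perception_pair_compose:
  assumes "perception_pair X \<Phi> G" "g \<in> G" "\<phi> \<in> \<Phi>"
  shows "compose X \<phi> g \<in> \<Phi>"
proof -
  have "G \<subseteq> carrier (Aut X \<Phi>)"
    using assms(1) by (simp add: perception_pair_def subgroup.subset)
  with assms show ?thesis by (auto simp: Aut_def)
qed

lemma perception_pair_funcset:
  assumes "perception_pair X \<Phi> G" "g \<in> G"
  shows "g \<in> X \<rightarrow> X"
proof -
  have "G \<subseteq> carrier (Aut X \<Phi>)"
    using assms(1) by (simp add: perception_pair_def subgroup.subset)
  with assms(2) show ?thesis by (auto simp: Aut_def dest: Bij_imp_funcset)
qed

lemma GENEO_op_comb:
  assumes X: "perception_pair X \<Phi> G" and Y: "perception_pair Y \<Psi> H"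
    and conv: "convex_wrt (fun_comb Y) \<Psi>"
    and F\<^sub>1: "GENEO X \<Phi> G Y \<Psi> H F\<^sub>1 T" and F\<^sub>2: "GENEO X \<Phi> G Y \<Psi> H F\<^sub>2 T"
    and t: "0 \<le> t" "t \<le> 1"
  shows "GENEO X \<Phi> G Y \<Psi> H (op_comb \<Phi> Y t F\<^sub>1 F\<^sub>2) T"
  unfolding GENEO_def
proof (intro conjI ballI)
  have mem: "F\<^sub>1 \<phi> \<in> \<Psi>" "F\<^sub>2 \<phi> \<in> \<Psi>" if "\<phi> \<in> \<Phi>" for \<phi>
    using F\<^sub>1 F\<^sub>2 that by (auto simp: GENEO_def)
  have comb: "fun_comb Y t (F\<^sub>1 \<phi>) (F\<^sub>2 \<phi>) \<in> \<Psi>" if "\<phi> \<in> \<Phi>" for \<phi>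
    using conv mem[OF that] t by (simp add: convex_wrt_def)
  then show "op_comb \<Phi> Y t F\<^sub>1 F\<^sub>2 \<in> \<Phi> \<rightarrow>\<^sub>E \<Psi>"
    by (auto simp: op_comb_def)
  show hom: "T \<in> hom ((Aut X \<Phi>)\<lparr>carrier := G\<rparr>) ((Aut Y \<Psi>)\<lparr>carrier := H\<rparr>)"
    using F\<^sub>1 by (simp add: GENEO_def)
  show "op_comb \<Phi> Y t F\<^sub>1 F\<^sub>2 (compose X \<phi> g) = compose Y (op_comb \<Phi> Y t F\<^sub>1 F\<^sub>2 \<phi>) (T g)"
    if "\<phi> \<in> \<Phi>" "g \<in> G" for \<phi> g
  proof -
    have "T g \<in> H"
      using hom \<open>g \<in> G\<close> by (auto simp: hom_def)
    then have "T g \<in> Y \<rightarrow> Y"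
      by (rule perception_pair_funcset[OF Y])
    \<comment> \<open>\<open>op_comb\<close> is restricted to \<open>\<Phi>\<close>, so unfolding it
      at \<open>compose X \<phi> g\<close> requires that this function lie in
      \<open>\<Phi>\<close>.\<close>
    then show ?thesis
      using F\<^sub>1 F\<^sub>2 that perception_pair_compose[OF X that(2,1)]
      by (simp add: op_comb_def GENEO_def compose_fun_comb)
  qed
  show "sup_dist Y (op_comb \<Phi> Y t F\<^sub>1 F\<^sub>2 \<phi>\<^sub>1) (op_comb \<Phi> Y t F\<^sub>1 F\<^sub>2 \<phi>\<^sub>2) \<le> sup_dist X \<phi>\<^sub>1 \<phi>\<^sub>2"
    if "\<phi>\<^sub>1 \<in> \<Phi>" "\<phi>\<^sub>2 \<in> \<Phi>" for \<phi>\<^sub>1 \<phi>\<^sub>2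
  proof -
    have "\<Psi> \<subseteq> bounded_funs Y"
      using Y by (simp add: perception_pair_def)
    moreover have "sup_dist Y (F\<^sub>1 \<phi>\<^sub>1) (F\<^sub>1 \<phi>\<^sub>2) \<le> sup_dist X \<phi>\<^sub>1 \<phi>\<^sub>2"
      "sup_dist Y (F\<^sub>2 \<phi>\<^sub>1) (F\<^sub>2 \<phi>\<^sub>2) \<le> sup_dist X \<phi>\<^sub>1 \<phi>\<^sub>2"
      using F\<^sub>1 F\<^sub>2 that by (auto simp: GENEO_def)
    \<comment> \<open>Here \<open>c\<close> is
      \<open>sup_dist X \<phi>\<^sub>1 \<phi>\<^sub>2\<close>; the combinations are bounded because
      they lie in \<open>\<Psi>\<close>.\<close>
    ultimately have "sup_dist Y (fun_comb Y t (F\<^sub>1 \<phi>\<^sub>1) (F\<^sub>2 \<phi>\<^sub>1)) (fun_comb Y t (F\<^sub>1 \<phi>\<^sub>2) (F\<^sub>2 \<phi>\<^sub>2))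
        \<le> sup_dist X \<phi>\<^sub>1 \<phi>\<^sub>2"
      using mem comb that t by (intro sup_dist_fun_comb_le) (auto dest: subsetD)
    then show ?thesis
      using that by (simp add: op_comb_def)
  qed
qed

theorem theorem13:
  fixes X :: "'x set" and \<Phi> :: "('x \<Rightarrow> real ^ 'n) set" and G :: "('x \<Rightarrow> 'x) set"
    and Y :: "'y set" and \<Psi> :: "('y \<Rightarrow> real ^ 'm) set" and H :: "('y \<Rightarrow> 'y) set"
    and T :: "('x \<Rightarrow> 'x) \<Rightarrow> ('y \<Rightarrow> 'y)"
  assumes "perception_pair X \<Phi> G"
    and "perception_pair Y \<Psi> H"
    and "T \<in> hom ((Aut X \<Phi>)\<lparr>carrier := G\<rparr>) ((Aut Y \<Psi>)\<lparr>carrier := H\<rparr>)"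
    and "convex_wrt (fun_comb Y) \<Psi>"
  shows "convex_wrt (op_comb \<Phi> Y) {F. GENEO X \<Phi> G Y \<Psi> H F T} \<and>
    (\<forall>F\<^sub>1 F\<^sub>2 t. GENEO X \<Phi> G Y \<Psi> H F\<^sub>1 T \<longrightarrow> GENEO X \<Phi> G Y \<Psi> H F\<^sub>2 T \<longrightarrow> 0 \<le> t \<longrightarrow> t \<le> 1 \<longrightarrow>
      GENEO X \<Phi> G Y \<Psi> H (op_comb \<Phi> Y t F\<^sub>1 F\<^sub>2) T)"
  using GENEO_op_comb[OF assms(1,2,4)] by (simp add: convex_wrt_def)

end
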